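(* Let $\Omega\subseteq\mathbb{R}^n$ be open and let $u:\Omega\to\mathbb{R}^N$ be an immersion in $C^2(\Omega)^N$. Suppose $u$ solves $|Du|^2[Du]^\bot\Delta u=0$ on $\Omega$. Then, for all $p\in[2,\infty]$, $u(\Omega)$ has $p$-Minimal Area, that is, for all $D\subset\subset\Omega$, all $h\in C^1(\overline D)$ and all $\nu\in\Gamma([Du]^\bot)$, $$\big\|Du\big\|_{L^p(D)}\le\big\|D(u+h\nu)\big\|_{L^p(D)}.$$ Conversely, if for some $p\in[2,\infty)$ the image $u(\Omega)$ has $p$-Minimal Area, then $u$ solves $|Du|^2[Du]^\bot\Delta u=0$ on $\Omega$.
   Context: Here $n,N\in\mathbb{N}$. $Du(x)\in\mathbb{R}^{N\times n}$ is the gradient matrix with entries $D_iu_\alpha$, $|Du|$ is its Euclidean (Frobenius) norm, and $\|Du\|_{L^p(D)}$ is the $L^p(D)$ norm of the function $|Du|$ (essential supremum if $p=\infty$). $u$ is an immersion if $\operatorname{rk}(Du)=n\le N$ everywhere on $\Omega$. $[Du(x)]^\bot$ is the orthogonal projection of $\mathbb{R}^N$ onto the nullspace of $Du(x)^\top$, and $\Delta u$ is the componentwise Laplacian. $D\subset\subset\Omega$ means that $D$ is a subdomain (open subset) whose closure is compact and contained in $\Omega$. $C^1(\overline D)$ is the set of real-valued functions that are $C^1$ up to the boundary (with no boundary condition). $\Gamma([Du]^\bot)$ is the set of normal vector fields along $u$, i.e. $C^1$ maps $\nu:\Omega\to\mathbb{R}^N$ with $\nu(x)^\top Du(x)=0$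 for all $x\in\Omega$. By definition, $u(\Omega)$ has $p$-Minimal Area if the displayed inequality holds for all such $D,h,\nu$. *)

theory Defs
  imports "HOL-Probability.Essential_Supremum"
begin

text \<open>
  The dimensions \<open>n\<close> and \<open>N\<close> are the cardinalities of the index types \<open>'n\<close> and \<open>'m\<close>.
  The gradient matrix \<open>Du(x)\<close>, with entries \<open>D\<^sub>iu\<^sub>\<alpha>\<close> (row \<open>\<alpha>\<close>, column \<open>i\<close>), is
  \<open>jacobian u (at x)\<close>. The library norm on \<open>real^'n^'m\<close> is the Frobenius norm.
\<close>

definition partial :: "'n::finite \<Rightarrow> (real^'n \<Rightarrow> 'b::real_normed_vector) \<Rightarrow> real^'n \<Rightarrow> 'b" where
  "partial i f x = frechet_derivative f (at x) (axis i 1)"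

text \<open>Differentiability classes, intended for open sets.\<close>

definition C1_on :: "(real^'n::finite) set \<Rightarrow> (real^'n \<Rightarrow> 'b::real_normed_vector) \<Rightarrow> bool" where
  "C1_on S f \<longleftrightarrow> (\<forall>x\<in>S. f differentiable (at x)) \<and> (\<forall>i. continuous_on S (partial i f))"

definition C2_on :: "(real^'n::finite) set \<Rightarrow> (real^'n \<Rightarrow> 'b::real_normed_vector) \<Rightarrow> bool" where
  "C2_on S f \<longleftrightarrow> C1_on S f \<and> (\<forall>i. C1_on S (partial i f))"

text \<open>\<open>C\<^sup>1\<close> up to the boundary: \<open>h\<close> is continuous on the closure of the open set \<open>D\<close>, \<open>C\<^sup>1\<close> in \<open>D\<close>,
  and its first derivatives extend continuously from \<open>D\<close> to the closure.\<close>

definition C1_closure :: "(real^'n::finite) set \<Rightarrow> (real^'n \<Rightarrow> real) \<Rightarrow> bool" where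
  "C1_closure D h \<longleftrightarrow> C1_on D h \<and> continuous_on (closure D) h \<and>
     (\<forall>i. \<exists>g. continuous_on (closure D) g \<and> (\<forall>x\<in>D. g x = partial i h x))"

definition laplacian :: "(real^'n::finite \<Rightarrow> real^'m::finite) \<Rightarrow> real^'n \<Rightarrow> real^'m" where
  "laplacian u x = (\<chi> \<alpha>. \<Sum>i\<in>UNIV. partial i (partial i (\<lambda>y. u y $ \<alpha>)) x)"

definition immersion_on :: "(real^'n::finite) set \<Rightarrow> (real^'n \<Rightarrow> real^'m::finite) \<Rightarrow> bool" where
  "immersion_on \<Omega> u \<longleftrightarrow>
     (\<forall>x\<in>\<Omega>. rank (jacobian u (at x)) = CARD('n) \<and> CARD('n) \<le> CARD('m))"

definition orth_proj :: "'a::euclidean_space set \<Rightarrow> 'a \<Rightarrow> 'a" where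
  "orth_proj S y = (THE z. z \<in> S \<and> (\<forall>w\<in>S. orthogonal (y - z) w))"

lemma orth_proj_unique_exists:
  fixes S :: "'a::euclidean_space set"
  assumes "subspace S"
  shows "\<exists>!z. z \<in> S \<and> (\<forall>w\<in>S. orthogonal (y - z) w)"
proof (rule ex_ex1I)
  obtain a b where "a \<in> span S" "\<And>w. w \<in> span S \<Longrightarrow> orthogonal b w" "y = a + b"
    using orthogonal_subspace_decomp_exists[of S y] by metis
  then show "\<exists>z. z \<in> S \<and> (\<forall>w\<in>S. orthogonal (y - z) w)"
    using assms by (intro exI[of _ a]) (simp add: span_eq_iff[THEN iffD2])
next
  fix z z'
  assume z: "z \<in> S \<and> (\<forall>w\<in>S. orthogonal (y - z) w)" and z': "z' \<in> S \<and> (\<forall>w\<in>S. orthogonal (y - z') w)"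
  have "z - z' \<in> S" using assms z z' by (simp add: subspace_diff)
  then have "(y - z') \<bullet> (z - z') = 0" "(y - z) \<bullet> (z - z') = 0"
    using z z' by (auto simp: orthogonal_def)
  then have "(z - z') \<bullet> (z - z') = 0" by (simp add: inner_diff_left)
  then show "z = z'" by simp
qed

definition normal_proj :: "(real^'n::finite \<Rightarrow> real^'m::finite) \<Rightarrow> real^'n \<Rightarrow> real^'m \<Rightarrow> real^'m" where
  "normal_proj u x = orth_proj {y. transpose (jacobian u (at x)) *v y = 0}"

definition solves_system :: "(real^'n::finite) set \<Rightarrow> (real^'n \<Rightarrow> real^'m::finite) \<Rightarrow> bool" where
  "solves_system \<Omega> u \<longleftrightarrow>
     (\<forall>x\<in>\<Omega>. (norm (jacobian u (at x)))\<^sup>2 *\<^sub>R normal_proj u x (laplacian u x) = 0)"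

definition normal_fields :: "(real^'n::finite) set \<Rightarrow> (real^'n \<Rightarrow> real^'m::finite) \<Rightarrow> (real^'n \<Rightarrow> real^'m) set" where
  "normal_fields \<Omega> u = {\<nu>. C1_on \<Omega> \<nu> \<and> (\<forall>x\<in>\<Omega>. \<nu> x v* jacobian u (at x) = 0)}"

definition Lp_norm :: "ennreal \<Rightarrow> 'a::euclidean_space set \<Rightarrow> ('a \<Rightarrow> 'b::real_normed_vector) \<Rightarrow> ennreal" where
  "Lp_norm p D f =
    (if p = \<infinity> then esssup (lebesgue_on D) (\<lambda>x. ennreal (norm (f x)))
     else (let I = (\<integral>\<^sup>+ x. ennreal (norm (f x) powr enn2real p) \<partial>lebesgue_on D)
           in if I = \<infinity> then \<infinity> else ennreal (enn2real I powr (1 / enn2real p))))"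

definition compactly_contained :: "'a::topological_space set \<Rightarrow> 'a set \<Rightarrow> bool" where
  "compactly_contained D \<Omega> \<longleftrightarrow> open D \<and> compact (closure D) \<and> closure D \<subseteq> \<Omega>"

definition p_minimal_area :: "ennreal \<Rightarrow> (real^'n::finite) set \<Rightarrow> (real^'n \<Rightarrow> real^'m::finite) \<Rightarrow> bool" where
  "p_minimal_area p \<Omega> u \<longleftrightarrow>
     (\<forall>D h \<nu>. compactly_contained D \<Omega> \<longrightarrow> C1_closure D h \<longrightarrow> \<nu> \<in> normal_fields \<Omega> u \<longrightarrow>
        Lp_norm p D (\<lambda>x. jacobian u (at x)) \<le>
        Lp_norm p D (\<lambda>x. jacobian (\<lambda>y. u y + h y *\<^sub>R \<nu> y) (at x)))"

end

theory Submission
  imports Defs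
begin

text \<open>
  The theorem is a pointwise statement in disguise. If \<open>\<nu>\<close> is normal along \<open>u\<close>, then differentiating
  \<open>\<nu> \<bullet> D\<^sub>iu = 0\<close> gives \<open>D\<^sub>i\<nu> \<bullet> D\<^sub>iu = - \<nu> \<bullet> D\<^sub>iD\<^sub>iu\<close>, so the cross terms of the variation collapse to the
  Laplacian and
  \<open>|D(u + h\<nu>)|\<^sup>2 = |Du|\<^sup>2 - 2h (\<nu> \<bullet> \<Delta>u) + |D(h\<nu>)|\<^sup>2\<close>
  (\<open>norm_jacobian_normal_variation\<close>). As an immersion has \<open>Du \<noteq> 0\<close> everywhere, the system says that
  \<open>\<Delta>u\<close> is tangential, so the middle term vanishes. Hence \<open>|Du| \<le> |D(u + h\<nu>)|\<close> at every point,
  and each \<open>L\<^sup>p\<close> norm inherits the inequality.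

  Conversely, let the normal part of \<open>\<Delta>u\<close> be nonzero at \<open>x\<^sub>0\<close>. Some global \<open>C\<^sup>1\<close> normal field \<open>\<nu>\<close>
  equals that normal part at \<open>x\<^sub>0\<close> (\<open>normal_field_through\<close>), whence \<open>\<nu> \<bullet> \<Delta>u > 0\<close> at \<open>x\<^sub>0\<close>. Because \<open>h\<close> is
  not required to vanish on the boundary, it may be a small constant \<open>t > 0\<close>: the linear term
  beats \<open>t\<^sup>2 |D\<nu>|\<^sup>2\<close>, and \<open>|D(u + t\<nu>)| < |Du|\<close> holds pointwise on a small ball around \<open>x\<^sub>0\<close>. For finite
  \<open>p\<close> the strict inequality passes to the norms (\<open>Lp_norm_strict_mono\<close>) and contradicts minimality.
\<close>

section \<open>Calculus of partial derivatives\<close>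

lemma partial_eqI: "(f has_derivative f') (at x) \<Longrightarrow> partial i f x = f' (axis i 1)"
  unfolding partial_def by (metis frechet_derivative_at)

lemma partial_const: "partial i (\<lambda>y. c) x = 0"
  by (rule partial_eqI[where f' = "\<lambda>_. 0", simplified]) simp

lemma partial_add:
  assumes "f differentiable (at x)" "g differentiable (at x)"
  shows "partial i (\<lambda>y. f y + g y) x = partial i f x + partial i g x"
proof -
  have "((\<lambda>y. f y + g y) has_derivative
      (\<lambda>v. frechet_derivative f (at x) v + frechet_derivative g (at x) v)) (at x)"
    using assms by (intro has_derivative_add) (simp_all add: frechet_derivative_works[symmetric])
  from partial_eqI[OF this] show ?thesis by (simp add: partial_def)
qed

lemma (in bounded_bilinear) partial_prod:
  assumes "f differentiable (at x)" "g differentiable (at x)"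
  shows "partial i (\<lambda>y. prod (f y) (g y)) x = prod (f x) (partial i g x) + prod (partial i f x) (g x)"
proof -
  have "((\<lambda>y. prod (f y) (g y)) has_derivative
      (\<lambda>v. prod (f x) (frechet_derivative g (at x) v) + prod (frechet_derivative f (at x) v) (g x))) (at x)"
    using assms by (intro FDERIV) (simp_all add: frechet_derivative_works[symmetric])
  from partial_eqI[OF this] show ?thesis by (simp add: partial_def)
qed

lemma (in bounded_bilinear) differentiable_prod:
  assumes "f differentiable (at x)" "g differentiable (at x)"
  shows "(\<lambda>y. prod (f y) (g y)) differentiable (at x)"
  using assms FDERIV unfolding differentiable_def by blast

lemma partial_component:
  assumes "f differentiable (at x)"
  shows "partial i (\<lambda>y. f y $ a) x = partial i f x $ a"
proof -
  have "((\<lambda>y. f y $ a) has_derivative (\<lambda>v. frechet_derivative f (at x) v $ a)) (at x)"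
    using assms by (intro bounded_linear.has_derivative[OF bounded_linear_vec_nth])
      (simp add: frechet_derivative_works[symmetric])
  from partial_eqI[OF this] show ?thesis by (simp add: partial_def)
qed

lemma partial_cong_open:
  assumes "open S" "x \<in> S" "\<And>y. y \<in> S \<Longrightarrow> f y = g y" "f differentiable (at x)"
  shows "partial i g x = partial i f x"
proof -
  have "(g has_derivative frechet_derivative f (at x)) (at x)"
    using assms has_derivative_transform_within_open[of f _ x UNIV S g]
    by (simp add: frechet_derivative_works[symmetric])
  from partial_eqI[OF this] show ?thesis by (simp add: partial_def)
qed

lemma C1_on_differentiable: "C1_on S f \<Longrightarrow> x \<in> S \<Longrightarrow> f differentiable (at x)"
  by (simp add: C1_on_def)

lemma C1_on_continuous: "C1_on S f \<Longrightarrow> continuous_on S f"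
  by (auto simp: C1_on_def intro!: continuous_at_imp_continuous_on differentiable_imp_continuous_within)

lemma C1_on_subset: "C1_on S f \<Longrightarrow> T \<subseteq> S \<Longrightarrow> C1_on T f"
  by (auto simp: C1_on_def intro: continuous_on_subset)

lemma C1_on_const: "C1_on S (\<lambda>x. c)"
  by (simp add: C1_on_def partial_const)

lemma C1_on_add:
  assumes "C1_on S f" "C1_on S g"
  shows "C1_on S (\<lambda>x. f x + g x)"
proof -
  have "continuous_on S (partial i (\<lambda>x. f x + g x))" for i
  proof (rule continuous_on_eq)
    show "continuous_on S (\<lambda>x. partial i f x + partial i g x)"
      using assms by (intro continuous_on_add) (auto simp: C1_on_def)
  qed (use assms in \<open>simp add: C1_on_def partial_add\<close>)
  then show ?thesis using assms by (auto simp: C1_on_def)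
qed

lemma (in bounded_bilinear) C1_on_prod:
  assumes "C1_on S f" "C1_on S g"
  shows "C1_on S (\<lambda>x. prod (f x) (g x))"
proof -
  have "continuous_on S (partial i (\<lambda>x. prod (f x) (g x)))" for i
  proof (rule continuous_on_eq)
    show "continuous_on S (\<lambda>x. prod (f x) (partial i g x) + prod (partial i f x) (g x))"
      using assms C1_on_continuous[OF assms(1)] C1_on_continuous[OF assms(2)]
      by (intro continuous_on_add continuous_on) (auto simp: C1_on_def)
  qed (use assms in \<open>simp add: C1_on_def partial_prod\<close>)
  then show ?thesis using assms by (auto simp: C1_on_def intro: differentiable_prod)
qed

lemmas C1_on_mult = bounded_bilinear.C1_on_prod[OF bounded_bilinear_mult]
lemmas C1_on_scaleR = bounded_bilinear.C1_on_prod[OF bounded_bilinear_scaleR]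
lemmas C1_on_inner = bounded_bilinear.C1_on_prod[OF bounded_bilinear_inner]

lemma C1_on_diff:
  assumes "C1_on S f" "C1_on S g"
  shows "C1_on S (\<lambda>x. f x - g x)"
  using C1_on_add[OF assms(1) C1_on_scaleR[OF C1_on_const assms(2)], of "-1"] by simp

lemma C1_on_sum: "(\<And>k. k \<in> I \<Longrightarrow> C1_on S (f k)) \<Longrightarrow> C1_on S (\<lambda>x. \<Sum>k\<in>I. f k x)"
  by (induction I rule: infinite_finite_induct) (simp_all add: C1_on_const C1_on_add)

lemma C1_on_prod:
  fixes f :: "'a \<Rightarrow> real^'n \<Rightarrow> real"
  shows "(\<And>k. k \<in> I \<Longrightarrow> C1_on S (f k)) \<Longrightarrow> C1_on S (\<lambda>x. \<Prod>k\<in>I. f k x)"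
  by (induction I rule: infinite_finite_induct) (simp_all add: C1_on_const C1_on_mult)

lemma C1_on_det:
  fixes a :: "'k::finite \<Rightarrow> 'k \<Rightarrow> real^'n \<Rightarrow> real"
  assumes "\<And>i j. C1_on S (a i j)"
  shows "C1_on S (\<lambda>x. det (\<chi> i j. a i j x))"
  unfolding det_def by (simp, intro C1_on_sum C1_on_mult C1_on_const C1_on_prod assms)

section \<open>The gradient matrix and the Laplacian\<close>

lemma jacobian_nth: "jacobian f (at x) $ a $ i = partial i f x $ a"
  by (simp add: jacobian_def matrix_def partial_def)

lemma norm_jacobian_squared:
  "(norm (jacobian f (at x)))\<^sup>2 = (\<Sum>i\<in>UNIV. (norm (partial i f x))\<^sup>2)"
  unfolding power2_norm_eq_inner inner_vec_def jacobian_nth by (rule sum.swap)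

lemma continuous_on_jacobian:
  assumes "C1_on S f"
  shows "continuous_on S (\<lambda>x. jacobian f (at x))"
proof -
  have eq: "(\<lambda>x. jacobian f (at x)) = (\<lambda>x. \<chi> a i. partial i f x $ a)"
    by (simp add: fun_eq_iff vec_eq_iff jacobian_nth)
  show ?thesis unfolding eq using assms
    by (intro continuous_on_vec_lambda continuous_on_component) (auto simp: C1_on_def)
qed

lemma vector_jacobian_nth: "(v v* jacobian f (at x)) $ i = v \<bullet> partial i f x"
  by (simp add: vector_matrix_mult_def inner_vec_def jacobian_nth mult.commute)

lemma normal_fields_iff:
  "\<nu> \<in> normal_fields \<Omega> u \<longleftrightarrow> C1_on \<Omega> \<nu> \<and> (\<forall>x\<in>\<Omega>. \<forall>i. \<nu> x \<bullet> partial i u x = 0)"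
  by (simp add: normal_fields_def vec_eq_iff vector_jacobian_nth)

lemma laplacian_eq_sum:
  assumes "open \<Omega>" "C2_on \<Omega> u" "x \<in> \<Omega>"
  shows "laplacian u x = (\<Sum>i\<in>UNIV. partial i (partial i u) x)"
proof -
  have "partial i (partial i (\<lambda>y. u y $ a)) x = partial i (partial i u) x $ a" for i a
  proof -
    have d: "partial i u differentiable (at x)"
      using assms by (simp add: C2_on_def C1_on_def)
    have "partial i (partial i (\<lambda>y. u y $ a)) x = partial i (\<lambda>y. partial i u y $ a) x"
    proof (rule partial_cong_open[OF assms(1,3)])
      show "(\<lambda>y. partial i u y $ a) differentiable (at x)"
        using d bounded_linear.has_derivative[OF bounded_linear_vec_nth]
        unfolding differentiable_def by blast
    qed (use assms in \<open>simp add: C2_on_def C1_on_def partial_component\<close>)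
    then show ?thesis using partial_component[OF d] by simp
  qed
  then show ?thesis by (simp add: laplacian_def vec_eq_iff)
qed

text \<open>Both cross terms simplify: \<open>Dh\<close> multiplies \<open>\<nu> \<bullet> D\<^sub>iu = 0\<close>, and \<open>h\<close> multiplies the sum of the
  \<open>D\<^sub>i\<nu> \<bullet> D\<^sub>iu\<close>, which the product rule for \<open>\<nu> \<bullet> D\<^sub>iu = 0\<close> turns into \<open>- \<nu> \<bullet> \<Delta>u\<close>.\<close>

lemma norm_jacobian_normal_variation:
  fixes u :: "real^'n \<Rightarrow> real^'m"
  assumes "open \<Omega>" "C2_on \<Omega> u" "\<nu> \<in> normal_fields \<Omega> u" "x \<in> \<Omega>" "h differentiable (at x)"
  shows "(norm (jacobian (\<lambda>y. u y + h y *\<^sub>R \<nu> y) (at x)))\<^sup>2 =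
    (norm (jacobian u (at x)))\<^sup>2 - 2 * h x * (\<nu> x \<bullet> laplacian u x) +
    (norm (jacobian (\<lambda>y. h y *\<^sub>R \<nu> y) (at x)))\<^sup>2"
proof -
  have du: "u differentiable (at x)" and ddu: "\<And>i. partial i u differentiable (at x)"
    using assms by (simp_all add: C2_on_def C1_on_def)
  have d\<nu>: "\<nu> differentiable (at x)" and perp: "\<And>y i. y \<in> \<Omega> \<Longrightarrow> \<nu> y \<bullet> partial i u y = 0"
    using assms by (simp_all add: normal_fields_iff C1_on_def)
  have dh\<nu>: "(\<lambda>y. h y *\<^sub>R \<nu> y) differentiable (at x)"
    using assms(5) d\<nu> by (rule bounded_bilinear.differentiable_prod[OF bounded_bilinear_scaleR])
  have diff_perp: "partial i \<nu> x \<bullet> partial i u x = - (\<nu> x \<bullet> partial i (partial i u) x)" for i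
  proof -
    have "partial i (\<lambda>y. \<nu> y \<bullet> partial i u y) x = partial i (\<lambda>y. 0::real) x"
      using assms(1,4) perp by (intro partial_cong_open[of \<Omega>]) auto
    then show ?thesis
      using bounded_bilinear.partial_prod[OF bounded_bilinear_inner d\<nu> ddu, of i i]
      by (simp add: partial_const)
  qed
  have "(norm (partial i (\<lambda>y. u y + h y *\<^sub>R \<nu> y) x))\<^sup>2 =
      (norm (partial i u x))\<^sup>2 - 2 * h x * (\<nu> x \<bullet> partial i (partial i u) x) +
      (norm (partial i (\<lambda>y. h y *\<^sub>R \<nu> y) x))\<^sup>2" for i
  proof -
    have "partial i u x \<bullet> partial i (\<lambda>y. h y *\<^sub>R \<nu> y) x = - h x * (\<nu> x \<bullet> partial i (partial i u) x)"
      using bounded_bilinear.partial_prod[OF bounded_bilinear_scaleR assms(5) d\<nu>, of i]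
        diff_perp[of i] perp[OF assms(4), of i]
      by (simp add: inner_add_right inner_commute)
    then show ?thesis
      unfolding partial_add[OF du dh\<nu>] power2_norm_eq_inner
      by (simp add: inner_add_left inner_add_right inner_commute)
  qed
  then show ?thesis
    unfolding norm_jacobian_squared laplacian_eq_sum[OF assms(1,2,4)]
    by (simp add: sum.distrib sum_subtractf inner_sum_right sum_distrib_left)
qed

section \<open>Normal vectors of an immersion\<close>

lemma normal_space_eq:
  "{y. transpose (jacobian u (at x)) *v y = 0} = {y. \<forall>i. y \<bullet> partial i u x = 0}"
  by (simp add: transpose_matrix_vector vec_eq_iff vector_jacobian_nth)

lemma normal_proj_props:
  shows normal_proj_orthogonal_tangent: "normal_proj u x y \<bullet> partial i u x = 0"
    and normal_proj_residual: "(\<And>i. w \<bullet> partial i u x = 0) \<Longrightarrow> w \<bullet> normal_proj u x y = w \<bullet> y"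
proof -
  let ?S = "{y. \<forall>i. y \<bullet> partial i u x = 0}"
  have "subspace ?S"
    by (auto simp: subspace_def inner_add_left)
  from theI'[OF orth_proj_unique_exists[OF this, of y]]
  have *: "normal_proj u x y \<in> ?S \<and> (\<forall>w\<in>?S. orthogonal (y - normal_proj u x y) w)"
    unfolding normal_proj_def normal_space_eq orth_proj_def .
  show "normal_proj u x y \<bullet> partial i u x = 0" using * by simp
  show "w \<bullet> normal_proj u x y = w \<bullet> y" if "\<And>i. w \<bullet> partial i u x = 0"
    using * that by (auto simp: orthogonal_def inner_diff_left inner_commute[of w])
qed

lemma immersion_jacobian_nonzero:
  fixes u :: "real^'n \<Rightarrow> real^'m"
  assumes "immersion_on \<Omega> u" "x \<in> \<Omega>"
  shows "jacobian u (at x) \<noteq> 0"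
proof
  assume "jacobian u (at x) = 0"
  then have "rank (0 :: real^'n^'m) = CARD('n)" using assms by (auto simp: immersion_on_def)
  then show False by simp
qed

lemma solves_system_iff:
  assumes "immersion_on \<Omega> u"
  shows "solves_system \<Omega> u \<longleftrightarrow> (\<forall>x\<in>\<Omega>. normal_proj u x (laplacian u x) = 0)"
  using immersion_jacobian_nonzero[OF assms] by (auto simp: solves_system_def)

definition gram :: "('k::finite \<Rightarrow> 'a::real_inner) \<Rightarrow> real^'k^'k" where
  "gram e = (\<chi> i j. e i \<bullet> e j)"

lemma det_gram_immersion:
  fixes u :: "real^'n \<Rightarrow> real^'m"
  assumes "immersion_on \<Omega> u" "x \<in> \<Omega>"
  shows "det (gram (\<lambda>i. partial i u x)) \<noteq> 0"
proof -
  let ?J = "jacobian u (at x)" and ?G = "gram (\<lambda>i. partial i u x)"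
  have inj: "inj ((*v) ?J)"
    using assms by (simp add: immersion_on_def full_rank_injective)
  have G: "?G = transpose ?J ** ?J"
    by (simp add: vec_eq_iff gram_def matrix_matrix_mult_def transpose_def inner_vec_def jacobian_nth)
  have "v = 0" if "?G *v v = 0" for v
  proof -
    have "(?J *v v) \<bullet> (?J *v v) = v \<bullet> (?G *v v)"
      by (simp add: G matrix_vector_mul_assoc[symmetric] dot_lmul_matrix[symmetric]
          transpose_matrix_vector inner_commute)
    then have "?J *v v = ?J *v 0" using that by simp
    then show "v = 0" using inj by (meson injD)
  qed
  then have "\<exists>B. B ** ?G = mat 1" by (subst matrix_left_invertible_ker) blast
  then show ?thesis using invertible_left_inverse invertible_det_nz by blast
qed

text \<open>The numerators of Cramer's rule for the normal equations of projecting \<open>w\<close> onto the span of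
  the \<open>e k\<close>. Leaving the common denominator \<open>det (gram e)\<close> out keeps everything polynomial in
  \<open>e\<close>, so that smoothness needs no division.\<close>

definition cramer_numerator :: "('k::finite \<Rightarrow> 'a::real_inner) \<Rightarrow> 'a \<Rightarrow> 'k \<Rightarrow> real" where
  "cramer_numerator e w k = det (\<chi> i j. if j = k then w \<bullet> e i else e i \<bullet> e j)"

definition scaled_normal_part :: "('k::finite \<Rightarrow> 'a::real_inner) \<Rightarrow> 'a \<Rightarrow> 'a" where
  "scaled_normal_part e w = det (gram e) *\<^sub>R w - (\<Sum>k\<in>UNIV. cramer_numerator e w k *\<^sub>R e k)"

lemma scaled_normal_part_orthogonal:
  assumes "det (gram e) \<noteq> 0"
  shows "scaled_normal_part e w \<bullet> e i = 0"
proof -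
  let ?b = "\<chi> i. w \<bullet> e i" and ?a = "\<chi> k. cramer_numerator e w k / det (gram e)"
  have "gram e *v ?a = ?b"
    unfolding cramer[OF assms]
    by (simp add: vec_eq_iff cramer_numerator_def gram_def cong: if_cong)
  then have "(\<Sum>k\<in>UNIV. (e i \<bullet> e k) * (cramer_numerator e w k / det (gram e))) = w \<bullet> e i"
    by (auto simp: vec_eq_iff matrix_vector_mult_def gram_def)
  then have "(\<Sum>k\<in>UNIV. (e i \<bullet> e k) * cramer_numerator e w k) = det (gram e) * (w \<bullet> e i)"
    using assms by (simp add: sum_divide_distrib[symmetric] field_simps)
  then show ?thesis
    by (simp add: scaled_normal_part_def inner_diff_left inner_sum_left inner_commute[of "e i"] mult.commute)
qed

lemma scaled_normal_part_normal:
  fixes e :: "'k::finite \<Rightarrow> 'a::real_inner"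
  assumes "\<And>i. w \<bullet> e i = 0"
  shows "scaled_normal_part e w = det (gram e) *\<^sub>R w"
proof -
  have "cramer_numerator e w k = 0" for k
    \<comment> \<open>The column of right-hand sides is zero.\<close>
    unfolding cramer_numerator_def
    by (rule det_zero_column[of k]) (simp add: column_def vec_eq_iff assms)
  then show ?thesis by (simp add: scaled_normal_part_def)
qed

text \<open>The normal projection of the constant vector \<open>w\<close> onto the moving normal space, scaled by the
  Gram determinant, is normal and \<open>C\<^sup>1\<close> because it is a polynomial in the \<open>D\<^sub>iu\<close>. Dividing \<open>w\<close>
  by the Gram determinant at \<open>x\<^sub>0\<close> gives the prescribed value there.\<close>

lemma normal_field_through:
  fixes u :: "real^'n \<Rightarrow> real^'m"
  assumes "C2_on \<Omega> u" "immersion_on \<Omega> u" "x\<^sub>0 \<in> \<Omega>" "\<And>i. w \<bullet> partial i u x\<^sub>0 = 0"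
  obtains \<nu> where "\<nu> \<in> normal_fields \<Omega> u" "\<nu> x\<^sub>0 = w"
proof
  let ?d = "det (gram (\<lambda>i. partial i u x\<^sub>0))"
  define w' where "w' = (1 / ?d) *\<^sub>R w"
  let ?\<nu> = "\<lambda>x. scaled_normal_part (\<lambda>i. partial i u x) w'"
  have C1: "C1_on \<Omega> (\<lambda>x. partial i u x)" for i
    using assms(1) by (simp add: C2_on_def)
  have "C1_on \<Omega> (\<lambda>x. cramer_numerator (\<lambda>i. partial i u x) w' k)" for k
  proof -
    have "C1_on \<Omega> (\<lambda>x. if j = k then w' \<bullet> partial i u x else partial i u x \<bullet> partial j u x)" for i j
      by (cases "j = k") (simp_all add: C1_on_inner C1_on_const C1)
    then show ?thesis unfolding cramer_numerator_def by (rule C1_on_det)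
  qed
  then have "C1_on \<Omega> ?\<nu>"
    unfolding scaled_normal_part_def gram_def
    by (intro C1_on_diff C1_on_scaleR C1_on_sum C1_on_det C1_on_inner C1_on_const C1)
  moreover have "?\<nu> x \<bullet> partial i u x = 0" if "x \<in> \<Omega>" for x i
    by (rule scaled_normal_part_orthogonal[OF det_gram_immersion[OF assms(2) that]])
  ultimately show "?\<nu> \<in> normal_fields \<Omega> u" by (simp add: normal_fields_iff)
  have "?\<nu> x\<^sub>0 = ?d *\<^sub>R w'"
    by (rule scaled_normal_part_normal) (simp add: w'_def assms(4))
  then show "?\<nu> x\<^sub>0 = w"
    using det_gram_immersion[OF assms(2,3)] by (simp add: w'_def)
qed

section \<open>Monotonicity of the norms\<close>

lemma Lp_norm_mono:
  assumes "f \<in> borel_measurable (lebesgue_on D)" "\<And>x. x \<in> D \<Longrightarrow> norm (f x) \<le> norm (g x)"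
  shows "Lp_norm p D f \<le> Lp_norm p D g"
proof (cases "p = \<infinity>")
  case True
  have "AE x in lebesgue_on D. ennreal (norm (f x)) \<le> ennreal (norm (g x))"
    by (rule AE_I2) (use assms(2) in \<open>auto simp: ennreal_leI\<close>)
  then have "esssup (lebesgue_on D) (\<lambda>x. ennreal (norm (f x))) \<le>
      esssup (lebesgue_on D) (\<lambda>x. ennreal (norm (g x)))"
    using assms(1) by (intro esssup_AE_mono) measurable
  then show ?thesis using True by (simp add: Lp_norm_def)
next
  case False
  let ?q = "enn2real p"
  let ?I = "\<lambda>f. \<integral>\<^sup>+ x. ennreal (norm (f x) powr ?q) \<partial>lebesgue_on D"
  have "?I f \<le> ?I g"
    by (rule nn_integral_mono)
      (use assms(2) in \<open>auto intro!: ennreal_leI powr_mono2 simp: enn2real_nonneg\<close>)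
  moreover from this have "enn2real (?I f) \<le> enn2real (?I g)" if "?I g \<noteq> \<infinity>"
    using that by (intro enn2real_mono) (auto simp: top.not_eq_extremum)
  ultimately show ?thesis
    using False by (auto simp: Lp_norm_def Let_def top_unique intro!: ennreal_leI powr_mono2)
qed

lemma ennreal_enn2real_powr_less:
  assumes "a < b" "b < \<infinity>" "0 < s"
  shows "ennreal (enn2real a powr s) < ennreal (enn2real b powr s)"
proof -
  have "enn2real a < enn2real b"
    using assms(1,2) by (cases a; cases b) (auto simp: ennreal_less_iff)
  then have "enn2real a powr s < enn2real b powr s"
    using assms(3) by (intro powr_less_mono2) simp_all
  then show ?thesis by (simp add: ennreal_less_iff)
qed

lemma Lp_norm_strict_mono:
  fixes f g :: "'a::euclidean_space \<Rightarrow> 'b::euclidean_space"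
  assumes D: "open D" "D \<noteq> {}" "bounded D"
    and meas: "f \<in> borel_measurable (lebesgue_on D)" "g \<in> borel_measurable (lebesgue_on D)"
    and less: "\<And>x. x \<in> D \<Longrightarrow> norm (f x) < norm (g x)"
    and bdd: "\<And>x. x \<in> D \<Longrightarrow> norm (g x) \<le> B"
    and p: "0 < p" "p < \<infinity>"
  shows "Lp_norm p D f < Lp_norm p D g"
proof -
  let ?q = "enn2real p" and ?M = "lebesgue_on D"
  let ?I = "\<lambda>f. \<integral>\<^sup>+ x. ennreal (norm (f x) powr ?q) \<partial>?M"
  have q: "?q > 0" using p by (simp add: enn2real_positive_iff)
  have Dm: "D \<in> lmeasurable" using D by (simp add: lmeasurable_open)
  have emD: "emeasure ?M (space ?M) = emeasure lebesgue D"
    using Dm by (simp add: emeasure_restrict_space fmeasurableD)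
  have "?I g \<le> (\<integral>\<^sup>+ x. ennreal (B powr ?q) \<partial>?M)"
    by (rule nn_integral_mono) (use bdd q in \<open>auto intro!: ennreal_leI powr_mono2\<close>)
  also have "\<dots> < \<infinity>"
    using emD fmeasurableD2[OF Dm] by (simp add: ennreal_mult_less_top top.not_eq_extremum)
  finally have fin: "?I g < \<infinity>" .
  have le: "?I f \<le> ?I g"
    by (rule nn_integral_mono) (use less_imp_le[OF less] q in \<open>auto intro!: ennreal_leI powr_mono2\<close>)
  have "?I f < ?I g"
  proof (rule nn_integral_less)
    show "AE x in ?M. ennreal (norm (f x) powr ?q) \<le> ennreal (norm (g x) powr ?q)"
      by (rule AE_I2) (use less_imp_le[OF less] q in \<open>auto intro!: ennreal_leI powr_mono2\<close>)
    have "emeasure lebesgue D \<noteq> 0"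
      using open_not_negligible[OF D(1,2)] negligible_iff_emeasure0[OF fmeasurableD[OF Dm]] by blast
    then have "ae_filter ?M \<noteq> bot" unfolding ae_filter_eq_bot_iff emD .
    then have "\<not> (AE x in ?M. False)" unfolding trivial_limit_def .
    have less_powr: "norm (f x) powr ?q < norm (g x) powr ?q" if "x \<in> D" for x
      using less[OF that] q by (intro powr_less_mono2) auto
    have "AE x in ?M. ennreal (norm (g x) powr ?q) \<le> ennreal (norm (f x) powr ?q) \<longrightarrow> False"
      by (rule AE_I2) (use less_powr in \<open>auto simp: not_le ennreal_less_iff\<close>)
    from AE_mp[OF _ this] \<open>\<not> (AE x in ?M. False)\<close>
    show "\<not> (AE x in ?M. ennreal (norm (g x) powr ?q) \<le> ennreal (norm (f x) powr ?q))"
      by (rule contrapos_nn[rotated])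
  qed (use meas le fin in auto)
  then have "ennreal (enn2real (?I f) powr (1 / ?q)) < ennreal (enn2real (?I g) powr (1 / ?q))"
    using fin q by (intro ennreal_enn2real_powr_less) simp_all
  moreover have "?I f \<noteq> \<infinity>" "?I g \<noteq> \<infinity>" "p \<noteq> \<infinity>"
    using fin le p by (auto simp: top_unique)
  ultimately show ?thesis
    unfolding Lp_norm_def Let_def by (simp only: if_False)
qed

section \<open>Minimality and the system\<close>

lemma solution_minimal:
  fixes u :: "real^'n \<Rightarrow> real^'m"
  assumes "open \<Omega>" "C2_on \<Omega> u" "immersion_on \<Omega> u" "solves_system \<Omega> u"
  shows "p_minimal_area p \<Omega> u"
  unfolding p_minimal_area_def
proof (intro allI impI)
  fix D h \<nu>
  assume D: "compactly_contained D \<Omega>" and h: "C1_closure D h" and \<nu>: "\<nu> \<in> normal_fields \<Omega> u"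
  have sub: "D \<subseteq> \<Omega>" and "open D"
    using D closure_subset[of D] by (auto simp: compactly_contained_def)
  show "Lp_norm p D (\<lambda>x. jacobian u (at x)) \<le> Lp_norm p D (\<lambda>x. jacobian (\<lambda>y. u y + h y *\<^sub>R \<nu> y) (at x))"
  proof (rule Lp_norm_mono)
    have "C1_on D u" using assms(2) sub by (auto simp: C2_on_def intro: C1_on_subset)
    then show "(\<lambda>x. jacobian u (at x)) \<in> borel_measurable (lebesgue_on D)"
      using \<open>open D\<close> by (intro continuous_imp_measurable_on_sets_lebesgue continuous_on_jacobian) auto
    fix x assume x: "x \<in> D"
    have "\<nu> x \<bullet> laplacian u x = \<nu> x \<bullet> normal_proj u x (laplacian u x)"
      using \<nu> x sub by (intro normal_proj_residual[symmetric]) (auto simp: normal_fields_iff)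
    then have "\<nu> x \<bullet> laplacian u x = 0"
      using assms(3,4) x sub by (auto simp: solves_system_iff)
    moreover have "h differentiable (at x)"
      using h x by (simp add: C1_closure_def C1_on_def)
    ultimately have "(norm (jacobian u (at x)))\<^sup>2 \<le> (norm (jacobian (\<lambda>y. u y + h y *\<^sub>R \<nu> y) (at x)))\<^sup>2"
      using norm_jacobian_normal_variation[OF assms(1,2) \<nu> subsetD[OF sub x], of h] by simp
    then show "norm (jacobian u (at x)) \<le> norm (jacobian (\<lambda>y. u y + h y *\<^sub>R \<nu> y) (at x))"
      by (rule power2_le_imp_le) simp
  qed
qed

lemma continuous_on_laplacian:
  assumes "open \<Omega>" "C2_on \<Omega> u"
  shows "continuous_on \<Omega> (laplacian u)"
proof (rule continuous_on_eq)
  show "continuous_on \<Omega> (\<lambda>x. \<Sum>i\<in>UNIV. partial i (partial i u) x)"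
    using assms(2) by (intro continuous_on_sum) (simp add: C2_on_def C1_on_def)
qed (use laplacian_eq_sum[OF assms] in simp)

text \<open>With \<open>h = t\<close> constant, \<open>|D(u + t\<nu>)|\<^sup>2 - |Du|\<^sup>2 = - t F\<close> for
  \<open>F = 2 (\<nu> \<bullet> \<Delta>u) - t |D\<nu>|\<^sup>2\<close>. It suffices to fix \<open>t\<close> with \<open>F x\<^sub>0 > 0\<close>; continuity of \<open>F\<close> then
  gives the ball.\<close>

lemma decreasing_normal_variation:
  fixes u :: "real^'n \<Rightarrow> real^'m"
  assumes "open \<Omega>" "C2_on \<Omega> u" "\<nu> \<in> normal_fields \<Omega> u" "x\<^sub>0 \<in> \<Omega>" "\<nu> x\<^sub>0 \<bullet> laplacian u x\<^sub>0 > 0"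
  obtains t r where "r > 0" "cball x\<^sub>0 r \<subseteq> \<Omega>"
    "\<And>x. x \<in> ball x\<^sub>0 r \<Longrightarrow> norm (jacobian (\<lambda>y. u y + t *\<^sub>R \<nu> y) (at x)) < norm (jacobian u (at x))"
proof -
  have C1\<nu>: "C1_on \<Omega> \<nu>" using assms(3) by (simp add: normal_fields_iff)
  let ?n = "\<lambda>x. (norm (jacobian \<nu> (at x)))\<^sup>2"
  define c where "c = \<nu> x\<^sub>0 \<bullet> laplacian u x\<^sub>0"
  define t where "t = c / (?n x\<^sub>0 + 1)"
  have "c > 0" using assms(5) by (simp add: c_def)
  have n1: "?n x\<^sub>0 + 1 > 0" by (simp add: add_nonneg_pos)
  have t: "t > 0" using \<open>c > 0\<close> n1 by (simp add: t_def)
  have "t * (?n x\<^sub>0 + 1) = c" using n1 by (simp add: t_def)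
  then have tn: "t * ?n x\<^sub>0 < 2 * c" using t \<open>c > 0\<close> by (simp add: distrib_left)
  define F where "F = (\<lambda>x. 2 * (\<nu> x \<bullet> laplacian u x) - t * ?n x)"
  have "continuous_on \<Omega> F" unfolding F_def
    using C1\<nu> by (intro continuous_intros C1_on_continuous continuous_on_laplacian[OF assms(1,2)]
        continuous_on_jacobian) auto
  then have "open {x \<in> \<Omega>. F x > 0}"
    using assms(1) continuous_openin_preimage_gen[of \<Omega> F "{0<..}"]
    by (simp add: openin_open_eq vimage_def Int_def)
  moreover have "x\<^sub>0 \<in> {x \<in> \<Omega>. F x > 0}" using assms(4) tn by (simp add: F_def c_def)
  ultimately obtain r where r: "r > 0" "cball x\<^sub>0 r \<subseteq> {x \<in> \<Omega>. F x > 0}"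
    by (meson open_contains_cball)
  have "norm (jacobian (\<lambda>y. u y + t *\<^sub>R \<nu> y) (at x)) < norm (jacobian u (at x))" if "x \<in> ball x\<^sub>0 r" for x
  proof -
    have x: "x \<in> \<Omega>" "F x > 0" using subsetD[OF r(2), of x] that by auto
    have d\<nu>: "\<nu> differentiable (at x)" using C1\<nu> x(1) by (rule C1_on_differentiable)
    have "partial i (\<lambda>y. t *\<^sub>R \<nu> y) x = t *\<^sub>R partial i \<nu> x" for i
      using bounded_bilinear.partial_prod[OF bounded_bilinear_scaleR differentiable_const d\<nu>, of i t]
      by (simp add: partial_const)
    then have "(norm (jacobian (\<lambda>y. t *\<^sub>R \<nu> y) (at x)))\<^sup>2 = t\<^sup>2 * ?n x"
      by (simp add: norm_jacobian_squared power_mult_distrib sum_distrib_left)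
    then have "(norm (jacobian (\<lambda>y. u y + t *\<^sub>R \<nu> y) (at x)))\<^sup>2 = (norm (jacobian u (at x)))\<^sup>2 - t * F x"
      using norm_jacobian_normal_variation[OF assms(1-3) x(1), of "\<lambda>_. t"]
      by (simp add: F_def algebra_simps power2_eq_square)
    then have "(norm (jacobian (\<lambda>y. u y + t *\<^sub>R \<nu> y) (at x)))\<^sup>2 < (norm (jacobian u (at x)))\<^sup>2"
      using t x(2) by simp
    then show ?thesis by (rule power2_less_imp_less) simp
  qed
  then show thesis using that[of r t] r by auto
qed

lemma minimal_solution:
  fixes u :: "real^'n \<Rightarrow> real^'m"
  assumes "open \<Omega>" "C2_on \<Omega> u" "immersion_on \<Omega> u"
    and p: "0 < p" "p < \<infinity>" and min: "p_minimal_area p \<Omega> u"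
  shows "solves_system \<Omega> u"
proof (rule ccontr)
  assume "\<not> solves_system \<Omega> u"
  then obtain x\<^sub>0 where x\<^sub>0: "x\<^sub>0 \<in> \<Omega>" and w0: "normal_proj u x\<^sub>0 (laplacian u x\<^sub>0) \<noteq> 0"
    by (auto simp: solves_system_iff[OF assms(3)])
  define w where "w = normal_proj u x\<^sub>0 (laplacian u x\<^sub>0)"
  have perp: "w \<bullet> partial i u x\<^sub>0 = 0" for i
    unfolding w_def by (rule normal_proj_orthogonal_tangent)
  obtain \<nu> where \<nu>: "\<nu> \<in> normal_fields \<Omega> u" "\<nu> x\<^sub>0 = w"
    using normal_field_through[OF assms(2,3) x\<^sub>0 perp] by blast
  have "w \<bullet> laplacian u x\<^sub>0 = w \<bullet> w"
    using normal_proj_residual[OF perp, of "laplacian u x\<^sub>0"] by (simp add: w_def)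
  then have pos: "\<nu> x\<^sub>0 \<bullet> laplacian u x\<^sub>0 > 0" using w0 \<nu>(2) by (simp add: w_def)
  obtain t r where r: "r > 0" "cball x\<^sub>0 r \<subseteq> \<Omega>" and
    less: "\<And>x. x \<in> ball x\<^sub>0 r \<Longrightarrow> norm (jacobian (\<lambda>y. u y + t *\<^sub>R \<nu> y) (at x)) < norm (jacobian u (at x))"
    using decreasing_normal_variation[OF assms(1,2) \<nu>(1) x\<^sub>0 pos] by metis
  let ?D = "ball x\<^sub>0 r" and ?v = "\<lambda>y. u y + t *\<^sub>R \<nu> y"
  have sub: "?D \<subseteq> \<Omega>" using r(2) ball_subset_cball by blast
  have C1u: "C1_on \<Omega> u" using assms(2) by (simp add: C2_on_def)
  have C1v: "C1_on \<Omega> ?v"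
    using \<nu>(1) by (intro C1_on_add C1u C1_on_scaleR C1_on_const) (simp add: normal_fields_iff)
  have "compact ((\<lambda>x. jacobian u (at x)) ` cball x\<^sub>0 r)"
    using continuous_on_jacobian[OF C1u] r(2)
    by (intro compact_continuous_image compact_cball) (rule continuous_on_subset)
  then obtain B where B: "\<And>x. x \<in> cball x\<^sub>0 r \<Longrightarrow> norm (jacobian u (at x)) \<le> B"
    using compact_imp_bounded bounded_iff by (metis imageI)
  have meas: "(\<lambda>x. jacobian f (at x)) \<in> borel_measurable (lebesgue_on ?D)"
    if "C1_on \<Omega> f" for f :: "real^'n \<Rightarrow> real^'m"
    using continuous_on_jacobian[OF C1_on_subset[OF that sub]]
    by (intro continuous_imp_measurable_on_sets_lebesgue) auto
  have "Lp_norm p ?D (\<lambda>x. jacobian ?v (at x)) < Lp_norm p ?D (\<lambda>x. jacobian u (at x))"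
  proof (rule Lp_norm_strict_mono[OF open_ball _ bounded_ball meas[OF C1v] meas[OF C1u] less _ p])
    show "?D \<noteq> {}" using r(1) by simp
    show "norm (jacobian u (at x)) \<le> B" if "x \<in> ?D" for x
      using that ball_subset_cball by (intro B) (rule subsetD)
  qed
  moreover have "compactly_contained ?D \<Omega>"
    using r by (simp add: compactly_contained_def)
  moreover have "C1_closure ?D (\<lambda>_. t)"
    by (auto simp: C1_closure_def C1_on_const partial_const intro: exI[of _ "\<lambda>_. 0"])
  ultimately show False
    using min \<nu>(1) unfolding p_minimal_area_def by (meson not_le)
qed

theorem lemma2p7:
  fixes \<Omega> :: "(real^'n) set" and u :: "real^'n \<Rightarrow> real^'m"
  assumes "open \<Omega>" and "C2_on \<Omega> u" and "immersion_on \<Omega> u"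
  shows "(solves_system \<Omega> u \<longrightarrow> (\<forall>p::ennreal. 2 \<le> p \<longrightarrow> p_minimal_area p \<Omega> u)) \<and>
         (\<forall>p::ennreal. 2 \<le> p \<and> p < \<infinity> \<and> p_minimal_area p \<Omega> u \<longrightarrow> solves_system \<Omega> u)"
proof (intro conjI impI allI)
  fix p :: ennreal
  show "p_minimal_area p \<Omega> u" if "solves_system \<Omega> u"
    using solution_minimal[OF assms that] .
  assume p: "2 \<le> p \<and> p < \<infinity> \<and> p_minimal_area p \<Omega> u"
  have "0 < p" using p by (metis less_le_trans zero_less_numeral)
  then show "solves_system \<Omega> u"
    using p minimal_solution[OF assms] by blast
qed

end
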